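(* For every $\epsilon>0$ and every positive integer $\ell$, there is a constant $c=c(\ell,\epsilon)>0$ such that for every $N$, every coloring of the $3$-element subsets (triples) of an $N$-element set with $\ell$ colors contains a subset $S$ of size $s=c\sqrt{\log N}$ such that at least $(1-\epsilon)\binom{s}{3}$ triples of $S$ have the same color.
   Context: All logarithms are in base $2$. Floor and ceiling signs are omitted where not crucial. *)

theory Defs
  imports Complex_Main "HOL-Library.Ramsey"
begin

end

theory Submission
  imports Defs "HOL-Library.Disjoint_Sets"
begin

text \<open>
  Build pairwise disjoint sets of size \<open>n\<close> one at a time out of a shrinking pool, so that a triple
  with its first two points in the \<open>i\<close>-th and \<open>j\<close>-th set and its third point in a later set (or in
  the pool) has a colour \<open>c i j\<close> depending on \<open>i < j\<close> only. For the next set, fix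
  \<open>2 ^ O(n)\<close> points \<open>X\<close> of the pool. For every other point \<open>v\<close> of the pool, \<open>n\<close> points of \<open>X\<close> induce
  the same colouring of the old sets through \<open>v\<close>; there are only \<open>2 ^ O(n\<^sup>2)\<close> choices of such points
  and of such a colouring, so one choice serves a fraction \<open>2 ^ (- O(n\<^sup>2))\<close> of the pool. Keeping the
  most popular colour in each old set costs a factor \<open>l\<close> in its size. Ramsey's theorem for the
  colouring \<open>c\<close> of pairs leaves \<open>d\<close> sets all of whose transversal triples have one colour, and for
  large \<open>d\<close> almost all triples of their union are transversal.
\<close>

section \<open>Pigeonhole: many pool points with a common colour profile\<close>

lemma pigeonhole_fibre:
  assumes "f \<in> A \<rightarrow> B" "finite A" "finite B" "B \<noteq> {}" "m * card B \<le> card A"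
  obtains y where "y \<in> B" "m \<le> card {x \<in> A. f x = y}"
proof -
  obtain y where y: "y \<in> B" "card A \<le> card (f -` {y} \<inter> A) * card B"
    using pigeonhole_card[OF assms(1-4)] by blast
  have "f -` {y} \<inter> A = {x \<in> A. f x = y}"
    by auto
  moreover have "card B > 0"
    using assms(3,4) by (simp add: card_gt_0_iff)
  ultimately have "m \<le> card {x \<in> A. f x = y}"
    using y(2) assms(5) by (metis le_trans mult_le_cancel2)
  with y(1) that show thesis by blast
qed

text \<open>Two pigeonholes. For fixed \<open>v\<close>, each \<open>b\<close> in \<open>X\<close>
  induces one of \<open>l ^ card U\<close> colourings of \<open>U\<close>, so \<open>n\<close> of
  the points of \<open>X\<close> induce the same one. Then there are at most
  \<open>card X ^ n * l ^ card U\<close> pairs of an \<open>n\<close>-subset and a colouring, so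
  some pair is chosen by at least \<open>m\<close> points \<open>v\<close>.\<close>

lemma common_profile:
  fixes f :: "'a \<Rightarrow> 'b \<Rightarrow> 'c \<Rightarrow> nat"
  assumes "finite U" "finite X" "finite W" "l > 0"
    and cX: "card X = n * l ^ card U"
    and cW: "m * (card X ^ n * l ^ card U) \<le> card W"
    and f: "\<And>a b v. a \<in> U \<Longrightarrow> b \<in> X \<Longrightarrow> v \<in> W \<Longrightarrow> f a b v < l"
  obtains B W' p where "B \<subseteq> X" "card B = n" "W' \<subseteq> W" "m \<le> card W'" "p \<in> U \<rightarrow> {..<l}"
    "\<And>a b v. a \<in> U \<Longrightarrow> b \<in> B \<Longrightarrow> v \<in> W' \<Longrightarrow> f a b v = p a"
proof -
  define P where "P = (U \<rightarrow>\<^sub>E {..<l})"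
  have P: "finite P" "P \<noteq> {}" "card P = l ^ card U"
    using \<open>finite U\<close> \<open>l > 0\<close>
    by (auto simp: P_def card_funcsetE PiE_eq_empty_iff intro!: finite_PiE)
  have "\<exists>q. q \<in> [X]\<^bsup>n\<^esup> \<times> P \<and> (\<forall>a\<in>U. \<forall>b\<in>fst q. f a b v = snd q a)" if "v \<in> W" for v
  proof -
    have "(\<lambda>b. \<lambda>a\<in>U. f a b v) \<in> X \<rightarrow> P"
      using f that by (auto simp: P_def)
    then obtain p where p: "p \<in> P" "n \<le> card {b \<in> X. (\<lambda>a\<in>U. f a b v) = p}"
      by (rule pigeonhole_fibre[OF _ \<open>finite X\<close> P(1,2), of _ n]) (simp add: cX P(3), rule that)
    obtain B where B: "B \<subseteq> {b \<in> X. (\<lambda>a\<in>U. f a b v) = p}" "card B = n"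
      by (rule obtain_subset_with_card_n[OF p(2)]) (rule that)
    then have "(B, p) \<in> [X]\<^bsup>n\<^esup> \<times> P"
      using p(1) \<open>finite X\<close> by (auto simp: nsets_def intro: finite_subset)
    moreover have "\<forall>a\<in>U. \<forall>b\<in>B. f a b v = p a"
      using B(1) by force
    ultimately show ?thesis
      by (metis fst_conv snd_conv)
  qed
  then obtain q where q: "\<And>v. v \<in> W \<Longrightarrow> q v \<in> [X]\<^bsup>n\<^esup> \<times> P"
      "\<And>v a b. v \<in> W \<Longrightarrow> a \<in> U \<Longrightarrow> b \<in> fst (q v) \<Longrightarrow> f a b v = snd (q v) a"
    by metis
  have "n \<le> card X"
    using cX \<open>l > 0\<close> by simp
  then have "card ([X]\<^bsup>n\<^esup> \<times> P) \<le> card X ^ n * l ^ card U"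
    by (simp add: card_cartesian_product P(3) binomial_le_pow)
  then have le: "m * card ([X]\<^bsup>n\<^esup> \<times> P) \<le> card W"
    using cW by (meson le_trans mult_le_mono2)
  have fin: "finite ([X]\<^bsup>n\<^esup> \<times> P)" "[X]\<^bsup>n\<^esup> \<times> P \<noteq> {}"
    using P \<open>finite X\<close> \<open>n \<le> card X\<close> by (auto simp: finite_imp_finite_nsets nsets_eq_empty_iff)
  have "q \<in> W \<rightarrow> [X]\<^bsup>n\<^esup> \<times> P"
    using q(1) by blast
  then obtain y where y: "y \<in> [X]\<^bsup>n\<^esup> \<times> P" "m \<le> card {v \<in> W. q v = y}"
    by (rule pigeonhole_fibre[OF _ \<open>finite W\<close> fin le]) (rule that)
  show thesis
  proof
    show "fst y \<subseteq> X" "card (fst y) = n" "snd y \<in> U \<rightarrow> {..<l}"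
      using y(1) by (auto simp: nsets_def P_def)
    show "{v \<in> W. q v = y} \<subseteq> W" "m \<le> card {v \<in> W. q v = y}"
      using y(2) by auto
    show "f a b v = snd y a" if "a \<in> U" "b \<in> fst y" "v \<in> {v \<in> W. q v = y}" for a b v
      using q(2) that by auto
  qed
qed

section \<open>Building the parts one by one\<close>

text \<open>
  The sets \<open>A 0, \<dots>, A (k - 1)\<close> are the parts built so far inside \<open>V\<close>, and \<open>W\<close> is the pool.
\<close>

definition tower ::
  "nat \<Rightarrow> ('a set \<Rightarrow> nat) \<Rightarrow> 'a set \<Rightarrow> nat \<Rightarrow> nat \<Rightarrow> (nat \<Rightarrow> 'a set) \<Rightarrow> 'a set \<Rightarrow> (nat \<Rightarrow> nat \<Rightarrow> nat) \<Rightarrow> bool"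
  where "tower l \<chi> V k n A W c \<longleftrightarrow> W \<subseteq> V \<and>
    (\<forall>i<k. A i \<subseteq> V \<and> card (A i) = n \<and> A i \<inter> W = {} \<and> (\<forall>j<k. i \<noteq> j \<longrightarrow> A i \<inter> A j = {})) \<and>
    (\<forall>i j. i < j \<longrightarrow> j < k \<longrightarrow> c i j < l \<and>
      (\<forall>a\<in>A i. \<forall>b\<in>A j. \<forall>v \<in> W \<union> (\<Union>h\<in>{j<..<k}. A h). \<chi> {a, b, v} = c i j))"

text \<open>The new part and the new pool both lie in the old pool, and the old parts only shrink,
  so old colours survive. For a new pair the colour depends at first on the point \<open>a\<close>,
  not on its part; passing to a most popular value of \<open>p\<close> in each old part repairs
  this, which is why the old parts have size \<open>l * n\<close>.\<close>

lemma tower_step: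
  assumes T: "tower l \<chi> V k (l * n) A W c" and "finite V" "l > 0" "n > 0"
    and \<chi>: "\<chi> \<in> [V]\<^bsup>3\<^esup> \<rightarrow> {..<l}"
    and x: "x = n * l ^ (k * (l * n))"
    and cW: "x + m * (x ^ n * l ^ (k * (l * n))) \<le> card W"
  obtains A' W' c' where "tower l \<chi> V (Suc k) n A' W' c'" "m \<le> card W'"
proof -
  note T = T[unfolded tower_def]
  have W: "W \<subseteq> V" "finite W"
    using T \<open>finite V\<close> by (auto intro: finite_subset)
  have A: "A i \<subseteq> V" "card (A i) = l * n" "A i \<inter> W = {}" if "i < k" for i
    using T that by blast+
  have finA: "finite (A i)" if "i < k" for i
    using A(1)[OF that] \<open>finite V\<close> by (rule finite_subset)
  have disj: "A i \<inter> A j = {}" if "i < k" "j < k" "i \<noteq> j" for i j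
    using T that by auto
  have c: "c i j < l" if "i < j" "j < k" for i j
    using T that by auto
  have col: "\<chi> {a, b, v} = c i j"
    if "i < j" "j < k" "a \<in> A i" "b \<in> A j" "v \<in> W \<union> (\<Union>h\<in>{j<..<k}. A h)" for i j a b v
    using T that by blast
  define U where "U = (\<Union>i<k. A i)"
  have U: "finite U" "U \<subseteq> V" "U \<inter> W = {}"
    unfolding U_def using A finA by blast+
  have cU: "card U = k * (l * n)"
    unfolding U_def using A finA disj by (subst card_UN_disjoint) auto
  have "x \<le> card W"
    using cW by simp
  then obtain X where X: "X \<subseteq> W" "card X = x" "finite X"
    using obtain_subset_with_card_n by metis
  \<comment> \<open>Taking \<open>v\<close> outside \<open>X\<close> makes \<open>a\<close>,
    \<open>b\<close>, \<open>v\<close> distinct, so that \<open>{a, b, v}\<close> really is a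
    coloured triple.\<close>
  have "m * (card X ^ n * l ^ card U) \<le> card (W - X)"
    using cW X W(2) by (simp add: card_Diff_subset cU)
  moreover have "\<chi> {a, b, v} < l" if "a \<in> U" "b \<in> X" "v \<in> W - X" for a b v
  proof -
    have "card {a, b, v} = 3"
      using that X(1) U(3) by (auto simp: card_insert_if)
    then have "{a, b, v} \<in> [V]\<^bsup>3\<^esup>"
      using that X(1) U(2) W by (auto simp: nsets_def)
    then show ?thesis using \<chi> by auto
  qed
  ultimately obtain B W' p where B: "B \<subseteq> X" "card B = n" and W': "W' \<subseteq> W - X" "m \<le> card W'"
    and p: "p \<in> U \<rightarrow> {..<l}" "\<And>a b v. a \<in> U \<Longrightarrow> b \<in> B \<Longrightarrow> v \<in> W' \<Longrightarrow> \<chi> {a, b, v} = p a"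
    using common_profile[of U X "W - X" l n m "\<lambda>a b v. \<chi> {a, b, v}"] U(1) X(2,3) W(2) x cU
      \<open>l > 0\<close> \<open>n > 0\<close> by (metis finite_Diff)
  have "\<exists>D e. D \<subseteq> A i \<and> card D = n \<and> e < l \<and> (\<forall>a\<in>D. p a = e)" if "i < k" for i
  proof -
    have pA: "p \<in> A i \<rightarrow> {..<l}"
      using p(1) that by (auto simp: U_def)
    have ne: "{..<l} \<noteq> {}" and le: "n * card {..<l} \<le> card (A i)"
      using A(2)[OF that] \<open>l > 0\<close> by (auto simp: mult.commute)
    obtain e where e: "e \<in> {..<l}" "n \<le> card {a \<in> A i. p a = e}"
      by (rule pigeonhole_fibre[OF pA finA[OF \<open>i < k\<close>] finite_lessThan ne le]) (rule that)
    obtain D where "D \<subseteq> {a \<in> A i. p a = e}" "card D = n"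
      by (rule obtain_subset_with_card_n[OF e(2)]) (rule that)
    with e(1) show ?thesis by blast
  qed
  then obtain D e where D: "\<And>i. i < k \<Longrightarrow> D i \<subseteq> A i \<and> card (D i) = n \<and> e i < l \<and> (\<forall>a\<in>D i. p a = e i)"
    by metis
  define A' where "A' = D(k := B)"
  \<comment> \<open>The new part has the largest index, so it can only be the second member of a new
    pair, and the popular value \<open>e i\<close> is the colour of that pair.\<close>
  define c' where "c' = (\<lambda>i j. if j = k then e i else c i j)"
  have BW: "B \<subseteq> W" "B \<inter> W' = {}"
    using B X W' by auto
  have DV: "D i \<subseteq> V" "D i \<inter> W' = {}" "D i \<inter> B = {}" if "i < k" for i
    using D[OF that] A[OF that] BW W' by blast+
  have DD: "D i \<inter> D j = {}" if "i < k" "j < k" "i \<noteq> j" for i j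
    using D[OF that(1)] D[OF that(2)] disj[OF that] by blast
  have "tower l \<chi> V (Suc k) n A' W' c'"
    unfolding tower_def
  proof (intro conjI allI impI ballI)
    show "W' \<subseteq> V"
      using W' W by auto
    show "A' i \<subseteq> V" "card (A' i) = n" "A' i \<inter> W' = {}" if "i < Suc k" for i
      using that D[of i] DV[of i] BW B(2) W by (cases "i = k"; simp add: A'_def less_Suc_eq)+
    show "A' i \<inter> A' j = {}" if "i < Suc k" "j < Suc k" "i \<noteq> j" for i j
      using that DV(3) DD by (cases "i = k"; cases "j = k"; simp add: A'_def less_Suc_eq Int_commute)
    show "c' i j < l" if "i < j" "j < Suc k" for i j
      using that c D by (auto simp: c'_def less_Suc_eq)
    show "\<chi> {a, b, v} = c' i j"
      if ij: "i < j" "j < Suc k" and ab: "a \<in> A' i" "b \<in> A' j"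
        and v: "v \<in> W' \<union> (\<Union>h\<in>{j<..<Suc k}. A' h)" for i j a b v
    proof (cases "j = k")
      case True
      \<comment> \<open>No part follows the new one, so the third point comes from the pool
        \<open>W'\<close>, where the profile \<open>p\<close> applies.\<close>
      moreover have "{k<..<Suc k} = {}"
        by auto
      ultimately have "a \<in> D i" "b \<in> B" "v \<in> W'" "i < k"
        using ij ab v by (simp_all add: A'_def)
      moreover from this have "a \<in> U"
        using D[of i] by (auto simp: U_def)
      ultimately show ?thesis
        using p(2) D True by (auto simp: c'_def)
    next
      case False
      then have "j < k"
        using ij by simp
      then have "a \<in> A i" "b \<in> A j"
        using ij ab D[of i] D[of j] by (auto simp: A'_def)
      \<comment> \<open>A third point in the new part \<open>B\<close> counts as a point of the old
        pool.\<close>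
      moreover have "v \<in> W \<union> (\<Union>h\<in>{j<..<k}. A h)"
        using v
      proof
        assume "v \<in> (\<Union>h\<in>{j<..<Suc k}. A' h)"
        then obtain h where h: "j < h" "h < Suc k" "v \<in> A' h"
          by auto
        show ?thesis
        proof (cases "h = k")
          case True
          with h BW show ?thesis by (auto simp: A'_def)
        next
          case False
          with h have "h \<in> {j<..<k}" "v \<in> A h"
            using D[of h] by (auto simp: A'_def)
          then show ?thesis by blast
        qed
      qed (use W' in blast)
      ultimately have "\<chi> {a, b, v} = c i j"
        by (rule col[OF ij(1) \<open>j < k\<close>])
      with False show ?thesis
        by (simp add: c'_def)
    qed
  qed
  with W'(2) that show thesis by blast
qed

text \<open>The loss in one step is exponential in \<open>n\<^sup>2\<close>, with a coefficient
  depending on \<open>k\<close> and \<open>l\<close> only; this produces the square root in the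
  theorem. The estimates are \<open>l \<le> 2 ^ l\<close> and \<open>n \<le> 2 ^ n\<close>.\<close>

lemma pool_loss_bound:
  fixes l n k :: nat
  assumes "n > 0" "m > 0" "l > 0"
  defines "x \<equiv> n * l ^ (k * (l * n))"
  shows "x + m * (x ^ n * l ^ (k * (l * n))) \<le> m * 2 ^ ((2 + 2 * k * l\<^sup>2) * n\<^sup>2)"
proof -
  define y where "y = l ^ (k * (l * n))"
  have "y \<le> (2 ^ l) ^ (k * (l * n))"
    unfolding y_def by (intro power_mono less_imp_le[OF less_exp]) auto
  also have "\<dots> = 2 ^ (k * l\<^sup>2 * n)"
    by (simp add: power2_eq_square mult.assoc mult.left_commute flip: power_mult)
  finally have y: "y \<le> 2 ^ (k * l\<^sup>2 * n)" .
  have "x \<le> 2 ^ n * 2 ^ (k * l\<^sup>2 * n)"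
    unfolding x_def y_def[symmetric] by (intro mult_mono y less_imp_le[OF less_exp]) auto
  also have "\<dots> = 2 ^ ((1 + k * l\<^sup>2) * n)"
    by (simp add: power_add algebra_simps)
  finally have "x ^ n \<le> (2 ^ ((1 + k * l\<^sup>2) * n)) ^ n"
    by (intro power_mono) auto
  also have "\<dots> = 2 ^ ((1 + k * l\<^sup>2) * n\<^sup>2)"
    by (simp add: power2_eq_square algebra_simps flip: power_mult)
  finally have xn: "x ^ n \<le> 2 ^ ((1 + k * l\<^sup>2) * n\<^sup>2)" .
  have "y \<le> 2 ^ (k * l\<^sup>2 * n\<^sup>2)"
    using y by (rule le_trans) (use \<open>n > 0\<close> in \<open>auto simp: power2_eq_square\<close>)
  with xn have "x ^ n * y \<le> 2 ^ ((1 + k * l\<^sup>2) * n\<^sup>2) * 2 ^ (k * l\<^sup>2 * n\<^sup>2)"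
    by (intro mult_mono) auto
  also have "\<dots> = 2 ^ ((1 + 2 * k * l\<^sup>2) * n\<^sup>2)"
    by (simp add: power_add[symmetric] algebra_simps)
  finally have xy: "x ^ n * y \<le> 2 ^ ((1 + 2 * k * l\<^sup>2) * n\<^sup>2)" .
  \<comment> \<open>Adding the \<open>x\<close> reserved points at most doubles the main term, and
    \<open>2 \<le> 2 ^ n\<^sup>2\<close> absorbs the doubling into the exponent.\<close>
  have "x > 0" "y > 0"
    using assms by (auto simp: x_def y_def)
  then have "x \<le> x ^ n * y"
    using \<open>n > 0\<close> by (metis One_nat_def Suc_leI mult_le_mono mult.right_neutral self_le_power)
  also have "\<dots> \<le> m * (x ^ n * y)"
    using \<open>m > 0\<close> by simp
  finally have "x + m * (x ^ n * y) \<le> m * (2 * (x ^ n * y))"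
    by linarith
  also have "\<dots> \<le> m * (2 ^ n\<^sup>2 * 2 ^ ((1 + 2 * k * l\<^sup>2) * n\<^sup>2))"
    using xy \<open>n > 0\<close> by (intro mult_le_mono2 mult_le_mono) (auto intro: self_le_power)
  also have "\<dots> = m * 2 ^ ((2 + 2 * k * l\<^sup>2) * n\<^sup>2)"
    by (simp add: power_add[symmetric] algebra_simps)
  finally show ?thesis
    unfolding y_def .
qed

text \<open>Induction on \<open>k\<close>, with \<open>n\<close> and \<open>m\<close> universally
  quantified under \<open>C\<close>: the next step needs earlier parts of size \<open>l * n\<close>
  and a pool large enough to pay for its loss.\<close>

lemma tower_exists:
  assumes "l > 0"
  shows "\<exists>C. \<forall>n m (V::'a set) \<chi>. n > 0 \<longrightarrow> m > 0 \<longrightarrow> finite V \<longrightarrow> \<chi> \<in> [V]\<^bsup>3\<^esup> \<rightarrow> {..<l} \<longrightarrow>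
    m * 2 ^ (C * n\<^sup>2) \<le> card V \<longrightarrow> (\<exists>A W c. tower l \<chi> V k n A W c \<and> m \<le> card W)"
proof (induction k)
  case 0
  have "tower l \<chi> V 0 n A V c" for n A c and V :: "'a set" and \<chi>
    by (simp add: tower_def)
  then show ?case
    by (intro exI[of _ 0]) (auto, blast)
next
  case (Suc k)
  then obtain C where C: "\<forall>n m (V::'a set) \<chi>. n > 0 \<longrightarrow> m > 0 \<longrightarrow> finite V \<longrightarrow> \<chi> \<in> [V]\<^bsup>3\<^esup> \<rightarrow> {..<l} \<longrightarrow>
    m * 2 ^ (C * n\<^sup>2) \<le> card V \<longrightarrow> (\<exists>A W c. tower l \<chi> V k n A W c \<and> m \<le> card W)"
    by (rule exE)
  show ?case
  \<comment> \<open>The first two summands are the loss of the last step;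
    \<open>C * l\<^sup>2\<close> comes from the earlier steps, run with parts of size
    \<open>l * n\<close>.\<close>
  proof (intro exI[of _ "2 + 2 * k * l\<^sup>2 + C * l\<^sup>2"] allI impI)
    fix n m :: nat and V :: "'a set" and \<chi>
    assume *: "n > 0" "m > 0" "finite V" "\<chi> \<in> [V]\<^bsup>3\<^esup> \<rightarrow> {..<l}"
      and V: "m * 2 ^ ((2 + 2 * k * l\<^sup>2 + C * l\<^sup>2) * n\<^sup>2) \<le> card V"
    define m' where "m' = m * 2 ^ ((2 + 2 * k * l\<^sup>2) * n\<^sup>2)"
    have "m' * 2 ^ (C * (l * n)\<^sup>2) = m * 2 ^ ((2 + 2 * k * l\<^sup>2 + C * l\<^sup>2) * n\<^sup>2)"
      by (simp add: m'_def power_add power_mult_distrib algebra_simps)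
    with V have "m' * 2 ^ (C * (l * n)\<^sup>2) \<le> card V"
      by (simp only:)
    then obtain A W c where "tower l \<chi> V k (l * n) A W c" "m' \<le> card W"
      using C[rule_format, of "l * n" m' V \<chi>] * \<open>l > 0\<close> by (auto simp: m'_def)
    moreover from this(2) have "n * l ^ (k * (l * n)) +
        m * ((n * l ^ (k * (l * n))) ^ n * l ^ (k * (l * n))) \<le> card W"
      using pool_loss_bound[OF *(1,2) \<open>l > 0\<close>, of k] by (simp only: m'_def)
    ultimately obtain A' W' c' where "tower l \<chi> V (Suc k) n A' W' c'" "m \<le> card W'"
      using tower_step[OF _ *(3) \<open>l > 0\<close> *(1,4) refl] by blast
    then show "\<exists>A W c. tower l \<chi> V (Suc k) n A W c \<and> m \<le> card W"
      by blast
  qed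
qed

section \<open>Ramsey's theorem on the indices of the parts\<close>

text \<open>The height \<open>t\<close> of the tower is a Ramsey number for pairs that depends on
  \<open>l\<close> and \<open>d\<close> only, so \<open>C\<close> does not depend on
  \<open>n\<close>. A set of indices monochromatic for \<open>c\<close> selects the parts.\<close>

lemma monochromatic_multipartite:
  fixes l d :: nat
  assumes "l > 0"
  shows "\<exists>C. \<forall>n (V::'a set) \<chi>. n > 0 \<longrightarrow> finite V \<longrightarrow> \<chi> \<in> [V]\<^bsup>3\<^esup> \<rightarrow> {..<l} \<longrightarrow> 2 ^ (C * n\<^sup>2) \<le> card V \<longrightarrow>
    (\<exists>(H::nat set) A e. finite H \<and> card H = d \<and> e < l \<and> disjoint_family_on A H \<and>
      (\<forall>i\<in>H. A i \<subseteq> V \<and> card (A i) = n) \<and>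
      (\<forall>i\<in>H. \<forall>j\<in>H. \<forall>h\<in>H. i < j \<longrightarrow> j < h \<longrightarrow>
        (\<forall>a\<in>A i. \<forall>b\<in>A j. \<forall>v\<in>A h. \<chi> {a, b, v} = e)))"
proof -
  obtain t :: nat where t: "partn_lst {..<t} (replicate l d) 2"
    using ramsey_full by blast
  obtain C where C: "\<forall>n m (V::'a set) \<chi>. n > 0 \<longrightarrow> m > 0 \<longrightarrow> finite V \<longrightarrow> \<chi> \<in> [V]\<^bsup>3\<^esup> \<rightarrow> {..<l} \<longrightarrow>
    m * 2 ^ (C * n\<^sup>2) \<le> card V \<longrightarrow> (\<exists>A W c. tower l \<chi> V t n A W c \<and> m \<le> card W)"
    using tower_exists[OF assms, of t] by (rule exE)
  show ?thesis
  proof (intro exI[of _ C] allI impI)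
    fix n :: nat and V :: "'a set" and \<chi>
    assume "n > 0" "finite V" "\<chi> \<in> [V]\<^bsup>3\<^esup> \<rightarrow> {..<l}" "2 ^ (C * n\<^sup>2) \<le> card V"
    then obtain A W c where T: "tower l \<chi> V t n A W c"
      using C[rule_format, of n 1 V \<chi>] by auto
    \<comment> \<open>Ramsey's theorem colours unordered pairs, whereas \<open>c\<close> is
      meaningful for \<open>i < j\<close> only.\<close>
    define g where "g = (\<lambda>P. c (Min P) (Max P))"
    have g: "g {i, j} = c i j" if "i < j" for i j
      using that by (simp add: g_def)
    have "g \<in> [{..<t}]\<^bsup>2\<^esup> \<rightarrow> {..<l}"
      using T g by (auto simp: ordered_nsets_2_eq tower_def)
    then obtain e H where e: "e < l" and H: "H \<in> [{..<t}]\<^bsup>d\<^esup>" "g ` [H]\<^bsup>2\<^esup> \<subseteq> {e}"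
      using t by (auto simp: partn_lst_def monochromatic_def)
    have H': "finite H" "card H = d" "H \<subseteq> {..<t}"
      using H(1) by (auto simp: nsets_def)
    have ce: "c i j = e" if "i \<in> H" "j \<in> H" "i < j" for i j
    proof -
      have "{i, j} \<in> [H]\<^bsup>2\<^esup>"
        using that by simp
      then have "g {i, j} \<in> {e}"
        using H(2) by blast
      then show ?thesis
        using g that by simp
    qed
    have "\<chi> {a, b, v} = e"
      if "i \<in> H" "j \<in> H" "h \<in> H" "i < j" "j < h" "a \<in> A i" "b \<in> A j" "v \<in> A h" for i j h a b v
    proof -
      have "h < t" "j < t"
        using that H' by auto
      then have "\<chi> {a, b, v} = c i j"
        using T that unfolding tower_def by fastforce
      with ce that show ?thesis by simp
    qed
    moreover have "A i \<subseteq> V \<and> card (A i) = n" if "i < t" for i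
      using T that unfolding tower_def by blast
    then have "\<forall>i\<in>H. A i \<subseteq> V \<and> card (A i) = n"
      using H'(3) by blast
    moreover have "A i \<inter> A j = {}" if "i < t" "j < t" "i \<noteq> j" for i j
      using T that unfolding tower_def by blast
    then have "disjoint_family_on A H"
      using H'(3) unfolding disjoint_family_on_def by blast
    ultimately show "\<exists>(H::nat set) A e. finite H \<and> card H = d \<and> e < l \<and> disjoint_family_on A H \<and>
      (\<forall>i\<in>H. A i \<subseteq> V \<and> card (A i) = n) \<and>
      (\<forall>i\<in>H. \<forall>j\<in>H. \<forall>h\<in>H. i < j \<longrightarrow> j < h \<longrightarrow>
        (\<forall>a\<in>A i. \<forall>b\<in>A j. \<forall>v\<in>A h. \<chi> {a, b, v} = e))"
      using H'(1,2) e by (intro exI[of _ H] exI[of _ A] exI[of _ e]) blast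
  qed
qed

section \<open>Counting the triples of the wrong colour\<close>

text \<open>A triple of a colour other than \<open>e\<close> has two points in one part, so it is
  recovered from that part, the pair inside it and the third point.\<close>

lemma card_nontransversal_triples_le:
  fixes H :: "nat set"
  assumes "finite H" "card H = d" "finite S" "card S = s"
    and A: "\<forall>i\<in>H. finite (A i) \<and> card (A i) = n"
    and S: "S \<subseteq> (\<Union>i\<in>H. A i)"
    and mono: "\<forall>i\<in>H. \<forall>j\<in>H. \<forall>h\<in>H. i < j \<longrightarrow> j < h \<longrightarrow>
      (\<forall>a\<in>A i. \<forall>b\<in>A j. \<forall>v\<in>A h. \<chi> {a, b, v} = (e::'c))"
  shows "card {T \<in> [S]\<^bsup>3\<^esup>. \<chi> T \<noteq> e} \<le> d * (n choose 2) * s"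
proof -
  define R where "R = (SIGMA i:H. [A i]\<^bsup>2\<^esup> \<times> S)"
  have fin: "finite R"
    unfolding R_def using assms by (intro finite_SigmaI finite_cartesian_product finite_imp_finite_nsets) auto
  have "{T \<in> [S]\<^bsup>3\<^esup>. \<chi> T \<noteq> e} \<subseteq> (\<lambda>(i, P, x). insert x P) ` R"
  proof
    fix T assume "T \<in> {T \<in> [S]\<^bsup>3\<^esup>. \<chi> T \<noteq> e}"
    then obtain x y z where T: "T = {x, y, z}" "x \<noteq> y" "y \<noteq> z" "x \<noteq> z" "{x, y, z} \<subseteq> S" "\<chi> T \<noteq> e"
      unfolding nsets_3_eq by auto
    have "\<exists>i\<in>H. a \<in> A i" if "a \<in> S" for a
      using S that by auto
    then obtain f where f: "\<And>a. a \<in> S \<Longrightarrow> f a \<in> H \<and> a \<in> A (f a)"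
      by metis
    have pair: "T \<in> (\<lambda>(i, P, x). insert x P) ` R"
      if "T = {a, b, v}" "f a = f b" "a \<noteq> b" "{a, b, v} \<subseteq> S" for a b v
    proof -
      have "(f a, {a, b}, v) \<in> R"
        using that f[of a] f[of b] by (auto simp: R_def)
      then show ?thesis
        by (rule rev_image_eqI) (use that in auto)
    qed
    have ordered: False if "T = {a, b, v}" "f a < f b" "f b < f v" "{a, b, v} \<subseteq> S" for a b v
      using mono[rule_format, of "f a" "f b" "f v" a b v] f that T(6) by auto
    \<comment> \<open>\<open>mono\<close> speaks of increasing indices, so each of the six orders of
      three distinct indices is ruled out.\<close>
    have "f x \<noteq> f y \<Longrightarrow> f y \<noteq> f z \<Longrightarrow> f x \<noteq> f z \<Longrightarrow> False"
      using ordered[of x y z] ordered[of x z y] ordered[of y x z] ordered[of y z x]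
        ordered[of z x y] ordered[of z y x] T(1,5) by (auto simp: insert_commute neq_iff)
    then consider "f x = f y" | "f y = f z" | "f x = f z"
      by blast
    then show "T \<in> (\<lambda>(i, P, x). insert x P) ` R"
      by cases (use pair[of x y z] pair[of y z x] pair[of x z y] T in \<open>auto simp: insert_commute\<close>)
  qed
  then have "card {T \<in> [S]\<^bsup>3\<^esup>. \<chi> T \<noteq> e} \<le> card R"
    using fin by (meson card_image_le card_mono finite_imageI le_trans)
  also have "card R = (\<Sum>i\<in>H. card ([A i]\<^bsup>2\<^esup> \<times> S))"
    unfolding R_def using assms
    by (intro card_SigmaI) (auto intro: finite_cartesian_product finite_imp_finite_nsets)
  also have "\<dots> = d * (n choose 2) * s"
    using assms by (simp add: card_cartesian_product)
  finally show ?thesis .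
qed

text \<open>For \<open>s \<ge> 3\<close> one has \<open>s - 1 \<ge> 2 * s / 3\<close> and
  \<open>s - 2 \<ge> s / 3\<close>; at \<open>s = 3\<close> equality holds.\<close>

lemma cube_le_choose_3:
  assumes "s \<ge> 3"
  shows "real s ^ 3 \<le> 27 * real (s choose 3)"
proof -
  have "real (s choose 3) = real s * (real s - 1) * (real s - 2) / 6"
    using assms by (simp add: binomial_gbinomial gbinomial_prod_rev eval_nat_numeral fact_Suc prod.lessThan_Suc algebra_simps)
  moreover have "real s * ((2 * real s / 3) * (real s / 3)) \<le> real s * ((real s - 1) * (real s - 2))"
    using assms by (intro mult_left_mono mult_mono) auto
  ultimately show ?thesis
    by (simp add: power3_eq_cube)
qed

text \<open>With \<open>q = s div d\<close>, the number of pairs is \<open>q * (q + 1) / 2\<close>,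
  at most \<open>q\<^sup>2\<close>, so the rounding up of the part size costs nothing.\<close>

lemma choose_2_div_bound:
  assumes "d > 0"
  shows "real (d * (Suc (s div d) choose 2) * s) \<le> real s ^ 3 / real d"
proof -
  define q where "q = s div d"
  have "real q \<le> real s / real d"
    unfolding q_def using of_nat_div_le_of_nat[of s d] by simp
  then have q: "(real q)\<^sup>2 \<le> (real s / real d)\<^sup>2"
    by (intro power_mono) auto
  have "Suc q choose 2 \<le> q\<^sup>2"
    unfolding choose_two power2_eq_square by (cases q) auto
  then have "real (Suc q choose 2) \<le> (real q)\<^sup>2"
    by (metis of_nat_le_iff of_nat_power)
  with q have "real (Suc q choose 2) \<le> (real s / real d)\<^sup>2"
    by linarith
  then have "real d * real (Suc q choose 2) * real s \<le> real d * (real s / real d)\<^sup>2 * real s"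
    by (intro mult_right_mono mult_left_mono) auto
  also have "\<dots> = real s ^ 3 / real d"
    using assms by (simp add: power2_eq_square power3_eq_cube)
  finally show ?thesis
    by (simp add: q_def)
qed

text \<open>Any \<open>s\<close> points of the union will do; the part size is rounded up so that
  there are that many. At most \<open>s ^ 3 / d\<close> triples are bad, hence at most a fraction
  \<open>27 / d\<close> of all, which is at most \<epsilon>.\<close>

lemma almost_monochromatic_subset:
  fixes H :: "nat set"
  assumes "finite H" "card H = d" "d > 0" "27 \<le> \<epsilon> * real d" "s \<ge> 3" "disjoint_family_on A H"
    and A: "\<forall>i\<in>H. finite (A i) \<and> card (A i) = Suc (s div d)"
    and mono: "\<forall>i\<in>H. \<forall>j\<in>H. \<forall>h\<in>H. i < j \<longrightarrow> j < h \<longrightarrow>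
      (\<forall>a\<in>A i. \<forall>b\<in>A j. \<forall>v\<in>A h. \<chi> {a, b, v} = (e::'c))"
  obtains S where "S \<subseteq> (\<Union>i\<in>H. A i)" "card S = s"
    "real (card {T \<in> [S]\<^bsup>3\<^esup>. \<chi> T = e}) \<ge> (1 - \<epsilon>) * real (s choose 3)"
proof -
  have "card (\<Union>i\<in>H. A i) = d * Suc (s div d)"
    using assms(1,2,6) A by (subst card_UN_disjoint) (auto simp: disjoint_family_on_def)
  then have "s \<le> card (\<Union>i\<in>H. A i)"
    using dividend_less_times_div[OF \<open>d > 0\<close>, of s] by simp
  then obtain S where S: "S \<subseteq> (\<Union>i\<in>H. A i)" "card S = s" "finite S"
    using obtain_subset_with_card_n by metis
  have "real (card {T \<in> [S]\<^bsup>3\<^esup>. \<chi> T \<noteq> e}) \<le> real (d * (Suc (s div d) choose 2) * s)"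
    using card_nontransversal_triples_le[OF assms(1,2) S(3,2) A S(1) mono] by (simp only: of_nat_le_iff)
  also have "\<dots> \<le> real s ^ 3 / real d"
    using choose_2_div_bound \<open>d > 0\<close> by blast
  also have "\<dots> \<le> 27 * real (s choose 3) / real d"
    using cube_le_choose_3[OF \<open>s \<ge> 3\<close>] by (intro divide_right_mono) auto
  also have "\<dots> \<le> \<epsilon> * real (s choose 3)"
    using mult_right_mono[OF assms(4), of "real (s choose 3)"] \<open>d > 0\<close> by (simp add: field_simps)
  finally have bad: "real (card {T \<in> [S]\<^bsup>3\<^esup>. \<chi> T \<noteq> e}) \<le> \<epsilon> * real (s choose 3)" .
  have "[S]\<^bsup>3\<^esup> = {T \<in> [S]\<^bsup>3\<^esup>. \<chi> T = e} \<union> {T \<in> [S]\<^bsup>3\<^esup>. \<chi> T \<noteq> e}"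
    by auto
  moreover have "card ({T \<in> [S]\<^bsup>3\<^esup>. \<chi> T = e} \<union> {T \<in> [S]\<^bsup>3\<^esup>. \<chi> T \<noteq> e}) =
      card {T \<in> [S]\<^bsup>3\<^esup>. \<chi> T = e} + card {T \<in> [S]\<^bsup>3\<^esup>. \<chi> T \<noteq> e}"
    using finite_imp_finite_nsets[OF S(3), of 3] by (intro card_Un_disjoint) auto
  ultimately have "card {T \<in> [S]\<^bsup>3\<^esup>. \<chi> T = e} + card {T \<in> [S]\<^bsup>3\<^esup>. \<chi> T \<noteq> e} = card ([S]\<^bsup>3\<^esup>)"
    by simp
  then have "real (card {T \<in> [S]\<^bsup>3\<^esup>. \<chi> T = e}) + real (card {T \<in> [S]\<^bsup>3\<^esup>. \<chi> T \<noteq> e}) = real (s choose 3)"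
    by (simp add: S(2) flip: of_nat_add)
  with bad have "real (card {T \<in> [S]\<^bsup>3\<^esup>. \<chi> T = e}) \<ge> (1 - \<epsilon>) * real (s choose 3)"
    by (simp add: algebra_simps)
  with S(1,2) that show thesis
    by blast
qed

section \<open>Choice of the constants and the case of small \<open>s\<close>\<close>

theorem theorem1:
  fixes \<epsilon> :: real and l :: nat
  assumes "\<epsilon> > 0" and "l > 0"
  shows "\<exists>c::real. c > 0 \<and>
    (\<forall>(N::nat) (V::'a set) (\<chi>::'a set \<Rightarrow> nat).
      finite V \<longrightarrow> card V = N \<longrightarrow> \<chi> \<in> [V]\<^bsup>3\<^esup> \<rightarrow> {..<l} \<longrightarrow>
      (\<exists>S s i. S \<subseteq> V \<and> s = nat \<lfloor>c * sqrt (log 2 (real N))\<rfloor> \<and> card S = s \<and> i < l \<and>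
        real (card {T \<in> [S]\<^bsup>3\<^esup>. \<chi> T = i}) \<ge> (1 - \<epsilon>) * real (s choose 3)))"
proof -
  obtain d :: nat where "27 / \<epsilon> < real d"
    using reals_Archimedean2 by blast
  then have d0: "27 < \<epsilon> * real d"
    using \<open>\<epsilon> > 0\<close> by (simp add: field_simps)
  \<comment> \<open>At least two parts are wanted, so that the part size
    \<open>Suc (s div d')\<close> does not exceed \<open>s\<close>.\<close>
  define d' where "d' = Suc (Suc d)"
  have d: "d' > 1" "27 \<le> \<epsilon> * real d'"
    using d0 \<open>\<epsilon> > 0\<close> by (auto simp: d'_def algebra_simps)
  obtain C where C: "\<forall>n (V::'a set) \<chi>. n > 0 \<longrightarrow> finite V \<longrightarrow> \<chi> \<in> [V]\<^bsup>3\<^esup> \<rightarrow> {..<l} \<longrightarrow> 2 ^ (C * n\<^sup>2) \<le> card V \<longrightarrow>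
    (\<exists>(H::nat set) A e. finite H \<and> card H = d' \<and> e < l \<and> disjoint_family_on A H \<and>
      (\<forall>i\<in>H. A i \<subseteq> V \<and> card (A i) = n) \<and>
      (\<forall>i\<in>H. \<forall>j\<in>H. \<forall>h\<in>H. i < j \<longrightarrow> j < h \<longrightarrow>
        (\<forall>a\<in>A i. \<forall>b\<in>A j. \<forall>v\<in>A h. \<chi> {a, b, v} = e)))"
    using monochromatic_multipartite[OF \<open>l > 0\<close>, of d'] by (rule exE)
  \<comment> \<open>The value of \<open>c\<close> turns the bound on \<open>s\<close> into
    \<open>2 ^ ((C + 1) * s\<^sup>2) \<le> N\<close>. The extra 1 keeps \<open>K\<close> positive
    and yields \<open>s \<le> N\<close> even if \<open>C = 0\<close>.\<close>
  define K where "K = real C + 1"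
  define c where "c = 1 / sqrt K"
  have K: "K > 0" and "c > 0" and c2: "K * c\<^sup>2 = 1"
    by (auto simp: K_def c_def power_divide)
  show ?thesis
  proof (intro exI[of _ c] conjI allI impI)
    fix N and V :: "'a set" and \<chi> :: "'a set \<Rightarrow> nat"
    assume V: "finite V" "card V = N" and \<chi>: "\<chi> \<in> [V]\<^bsup>3\<^esup> \<rightarrow> {..<l}"
    define s where "s = nat \<lfloor>c * sqrt (log 2 (real N))\<rfloor>"
    have s: "real s \<le> c * sqrt (log 2 (real N))" if "s > 0"
      using that unfolding s_def by linarith
    have pow: "2 ^ (C * s\<^sup>2) \<le> N" "s \<le> N" if "s > 0"
    proof -
      have "sqrt (log 2 (real N)) > 0"
        using s[OF that] that \<open>c > 0\<close> by (smt (verit) of_nat_0_less_iff zero_less_mult_pos)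
      then have L: "log 2 (real N) > 0"
        by simp
      \<comment> \<open>By convention \<open>log 2 0 = 0\<close>, so a positive logarithm excludes
        \<open>N = 0\<close>.\<close>
      then have "N > 0"
        by (cases N) (auto simp: log_def)
      have "(real s)\<^sup>2 \<le> (c * sqrt (log 2 (real N)))\<^sup>2"
        using s[OF that] by (intro power_mono) auto
      also have "\<dots> = c\<^sup>2 * log 2 (real N)"
        using L by (simp add: power_mult_distrib)
      finally have s2: "(real s)\<^sup>2 \<le> c\<^sup>2 * log 2 (real N)" .
      then have "K * (real s)\<^sup>2 \<le> (K * c\<^sup>2) * log 2 (real N)"
        using K by (simp add: mult.assoc)
      then have Ks: "K * (real s)\<^sup>2 \<le> log 2 (real N)"
        by (simp only: c2 mult_1)
      have "real ((C + 1) * s\<^sup>2) \<le> log 2 (real N)"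
        using Ks by (simp add: K_def algebra_simps)
      then have "2 ^ ((C + 1) * s\<^sup>2) \<le> real N"
        using \<open>N > 0\<close> by (simp add: le_log_iff powr_realpow[symmetric] del: of_nat_mult of_nat_add mult_Suc)
      then have *: "2 ^ ((C + 1) * s\<^sup>2) \<le> N"
        by (metis of_nat_le_iff of_nat_numeral of_nat_power)
      have "(2::nat) ^ (C * s\<^sup>2) \<le> 2 ^ ((C + 1) * s\<^sup>2)"
        by (intro power_increasing) auto
      with * show "2 ^ (C * s\<^sup>2) \<le> N"
        by linarith
      have "s \<le> (C + 1) * s\<^sup>2"
        using le_square[of s] by (simp add: power2_eq_square trans_le_add1)
      then have "s \<le> 2 ^ ((C + 1) * s\<^sup>2)"
        by (meson less_exp less_imp_le le_trans)
      with * show "s \<le> N"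
        by linarith
    qed
    have "\<exists>S i. S \<subseteq> V \<and> card S = s \<and> i < l \<and>
        real (card {T \<in> [S]\<^bsup>3\<^esup>. \<chi> T = i}) \<ge> (1 - \<epsilon>) * real (s choose 3)"
    proof (cases "s \<ge> 3")
      case True
      have "s div d' < s"
        using True d(1) by (intro div_less_dividend) auto
      then have "C * (Suc (s div d'))\<^sup>2 \<le> C * s\<^sup>2"
        by (intro mult_le_mono2 power_mono) auto
      then have "(2::nat) ^ (C * (Suc (s div d'))\<^sup>2) \<le> 2 ^ (C * s\<^sup>2)"
        by (intro power_increasing) auto
      then have big: "2 ^ (C * (Suc (s div d'))\<^sup>2) \<le> card V"
        using pow True V(2) by linarith
      obtain H :: "nat set" and A e where HA: "finite H" "card H = d'" "e < l" "disjoint_family_on A H"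
        "\<forall>i\<in>H. A i \<subseteq> V \<and> card (A i) = Suc (s div d')"
        "\<forall>i\<in>H. \<forall>j\<in>H. \<forall>h\<in>H. i < j \<longrightarrow> j < h \<longrightarrow>
          (\<forall>a\<in>A i. \<forall>b\<in>A j. \<forall>v\<in>A h. \<chi> {a, b, v} = e)"
        using C[rule_format, OF zero_less_Suc V(1) \<chi> big] by - (elim exE conjE, rule that)
      have A: "\<forall>i\<in>H. finite (A i) \<and> card (A i) = Suc (s div d')"
        using HA(5) V(1) finite_subset by blast
      have "d' > 0"
        using d(1) by simp
      then obtain S where S: "S \<subseteq> (\<Union>i\<in>H. A i)" "card S = s"
        "real (card {T \<in> [S]\<^bsup>3\<^esup>. \<chi> T = e}) \<ge> (1 - \<epsilon>) * real (s choose 3)"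
        by (rule almost_monochromatic_subset[
            OF HA(1,2) _ d(2) True HA(4) A HA(6)]) (rule that)
      moreover have "S \<subseteq> V"
        using S(1) HA(5) by blast
      ultimately show ?thesis
        using HA(3) by blast
    next
      \<comment> \<open>With fewer than three points there are no triples and the bound reads
        \<open>0 \<ge> 0\<close>; any \<open>s\<close>-subset of \<open>V\<close> with colour 0
        works.\<close>
      case False
      have "s \<le> card V"
        using pow V by (cases "s = 0") auto
      then obtain S where "S \<subseteq> V" "card S = s"
        using obtain_subset_with_card_n by metis
      with False \<open>l > 0\<close> show ?thesis
        by (intro exI[of _ S] exI[of _ 0]) (auto simp: binomial_eq_0)
    qed
    then show "\<exists>S s i. S \<subseteq> V \<and> s = nat \<lfloor>c * sqrt (log 2 (real N))\<rfloor> \<and> card S = s \<and> i < l \<and>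
        real (card {T \<in> [S]\<^bsup>3\<^esup>. \<chi> T = i}) \<ge> (1 - \<epsilon>) * real (s choose 3)"
      unfolding s_def by blast
  qed (rule \<open>c > 0\<close>)
qed

end
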